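(* Let $\mathcal{G}\subseteq 2^{\{1,\ldots,p\}}$ be a set of groups, let $(\eta_g)_{g\in\mathcal{G}}$ be positive weights, and let $\Omega$ be the norm on $\mathbb{R}^p$ given by $\Omega(\mathbf{w})=\sum_{g\in\mathcal{G}}\eta_g\|\mathbf{w}_g\|_\infty$, with dual norm $\Omega^*(\boldsymbol\kappa)=\max_{\Omega(\mathbf{z})\le 1}\mathbf{z}^\top\boldsymbol\kappa$. Then for every $\boldsymbol\kappa\in\mathbb{R}^p$, $$\Omega^*(\boldsymbol\kappa)=\min_{\boldsymbol\xi\in\mathbb{R}^{p\times|\mathcal{G}|},\ \tau\in\mathbb{R}}\ \tau\quad\text{s.t.}\quad\sum_{g\in\mathcal{G}}\boldsymbol\xi^g=\boldsymbol\kappa,\ \text{ and }\ \forall g\in\mathcal{G},\ \|\boldsymbol\xi^g\|_1\le\tau\eta_g\ \text{ with }\ \boldsymbol\xi^g_j=0\ \text{if}\ j\notin g.$$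
   Context: For $\mathbf{w}\in\mathbb{R}^p$ and $g\in\mathcal{G}$, $\mathbf{w}_g\in\mathbb{R}^{|g|}$ denotes the vector of the coefficients of $\mathbf{w}$ indexed by $g$. The groups are nonempty, may overlap arbitrarily, and their union is $\{1,\ldots,p\}$ (so that $\Omega$ is a norm). The matrix $\boldsymbol\xi=(\boldsymbol\xi^g)_{g\in\mathcal{G}}\in\mathbb{R}^{p\times|\mathcal{G}|}$ has one column $\boldsymbol\xi^g\in\mathbb{R}^p$ per group, and $\boldsymbol\xi^g_j$ is the $j$-th coordinate of $\boldsymbol\xi^g$. *)

theory Defs
  imports "HOL-Analysis.Analysis"
begin

text \<open>
  The index set \<open>{1,\<dots>,p}\<close> is rendered as the finite type \<open>'p\<close>, so that \<open>p = CARD('p)\<close>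
  and a set of groups has type \<open>'p set set\<close>; such a set is automatically finite.
\<close>

definition linf_on :: "'p::finite set \<Rightarrow> real ^ 'p \<Rightarrow> real"
  where "linf_on g w = (MAX j\<in>g. \<bar>w $ j\<bar>)"  (* meaningful for nonempty g only *)

definition l1_norm :: "real ^ 'p::finite \<Rightarrow> real"
  where "l1_norm x = (\<Sum>j\<in>UNIV. \<bar>x $ j\<bar>)"

definition group_norm :: "'p::finite set set \<Rightarrow> ('p set \<Rightarrow> real) \<Rightarrow> real ^ 'p \<Rightarrow> real"
  where "group_norm \<G> \<eta> w = (\<Sum>g\<in>\<G>. \<eta> g * linf_on g w)"

text \<open>
  The dual norm is a supremum here; the lemma \<open>dual_group_norm_max\<close> below shows that
  for the norms considered it is a maximum.
\<close>

definition dual_norm :: "(real ^ 'p::finite \<Rightarrow> real) \<Rightarrow> real ^ 'p \<Rightarrow> real"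
  where "dual_norm N \<kappa> = (SUP z\<in>{z. N z \<le> 1}. z \<bullet> \<kappa>)"

text \<open>
  The feasible pairs \<open>(\<xi>, \<tau>)\<close>. The matrix \<open>\<xi>\<close> is the function sending a group to
  its column; its values outside \<open>\<G>\<close> are unconstrained and irrelevant.
\<close>

definition feasible ::
  "'p::finite set set \<Rightarrow> ('p set \<Rightarrow> real) \<Rightarrow> real ^ 'p \<Rightarrow> (('p set \<Rightarrow> real ^ 'p) \<times> real) set"
  where "feasible \<G> \<eta> \<kappa> =
    {(\<xi>, \<tau>). (\<Sum>g\<in>\<G>. \<xi> g) = \<kappa> \<and>
      (\<forall>g\<in>\<G>. l1_norm (\<xi> g) \<le> \<tau> * \<eta> g \<and> (\<forall>j. j \<notin> g \<longrightarrow> \<xi> g $ j = 0))}"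

lemma linf_on_ge: "j \<in> g \<Longrightarrow> \<bar>w $ j\<bar> \<le> linf_on g w"
  by (simp add: linf_on_def)

lemma linf_on_nonneg: "g \<noteq> {} \<Longrightarrow> 0 \<le> linf_on g w"
  by (meson abs_ge_zero all_not_in_conv linf_on_ge order_trans)

lemma continuous_on_linf_on:
  fixes g :: "'a::finite set"
  assumes "g \<noteq> {}"
  shows "continuous_on UNIV (linf_on g)"
proof -
  have "finite g" by simp
  then show ?thesis using assms unfolding linf_on_def[abs_def]
  proof (induction rule: finite_ne_induct)
    case (singleton x)
    then show ?case by (simp add: continuous_on_rabs continuous_on_component continuous_on_id)
  next
    case (insert x F)
    have "continuous_on UNIV (\<lambda>w :: real ^ 'a. max \<bar>w $ x\<bar> (MAX j\<in>F. \<bar>w $ j\<bar>))"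
      by (intro continuous_on_max continuous_on_rabs continuous_on_component continuous_on_id
          insert.IH)
    moreover have "(MAX j\<in>insert x F. \<bar>w $ j\<bar>) = max \<bar>w $ x\<bar> (MAX j\<in>F. \<bar>w $ j\<bar>)"
      for w :: "real ^ 'a"
      using insert.hyps by simp
    ultimately show ?case by simp
  qed
qed

context
  fixes \<G> :: "'p::finite set set" and \<eta> :: "'p set \<Rightarrow> real"
  assumes ne: "{} \<notin> \<G>" and cover: "\<Union>\<G> = UNIV" and pos: "\<forall>g\<in>\<G>. 0 < \<eta> g"
begin

lemma in_some_group:
  obtains g where "g \<in> \<G>" "j \<in> g"
proof -
  have "j \<in> \<Union>\<G>" by (simp only: cover UNIV_I)
  then show ?thesis using that by (elim UnionE)
qed

lemma summand_nonneg: "g \<in> \<G> \<Longrightarrow> 0 \<le> \<eta> g * linf_on g w"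
  using ne pos by (metis less_imp_le linf_on_nonneg mult_nonneg_nonneg)

lemma group_norm_ge: "g \<in> \<G> \<Longrightarrow> j \<in> g \<Longrightarrow> \<eta> g * \<bar>w $ j\<bar> \<le> group_norm \<G> \<eta> w"
proof -
  assume g: "g \<in> \<G>" and j: "j \<in> g"
  have "\<eta> g * \<bar>w $ j\<bar> \<le> \<eta> g * linf_on g w"
    using g j pos by (intro mult_left_mono linf_on_ge) (auto intro: less_imp_le)
  also have "\<dots> \<le> group_norm \<G> \<eta> w"
    unfolding group_norm_def
    using g by (intro member_le_sum) (simp_all add: summand_nonneg)
  finally show ?thesis .
qed

lemma group_norm_nonneg: "0 \<le> group_norm \<G> \<eta> w"
  unfolding group_norm_def by (intro sum_nonneg summand_nonneg)

lemma group_norm_eq_0_iff: "group_norm \<G> \<eta> w = 0 \<longleftrightarrow> w = 0"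
proof
  assume 0: "group_norm \<G> \<eta> w = 0"
  have "w $ j = 0" for j
  proof -
    obtain g where g: "g \<in> \<G>" "j \<in> g" by (rule in_some_group)
    then have "\<eta> g * \<bar>w $ j\<bar> \<le> 0" using group_norm_ge[OF g, of w] 0 by simp
    moreover have "0 < \<eta> g" using pos g by blast
    ultimately show ?thesis by (simp add: mult_le_0_iff)
  qed
  then show "w = 0" by (simp add: vec_eq_iff)
next
  assume "w = 0"
  moreover have "linf_on g (0 :: real ^ 'p) = 0" if "g \<in> \<G>" for g
    using that ne by (auto simp: linf_on_def image_constant_conv)
  ultimately show "group_norm \<G> \<eta> w = 0" by (simp add: group_norm_def)
qed

lemma group_norm_triangle: "group_norm \<G> \<eta> (v + w) \<le> group_norm \<G> \<eta> v + group_norm \<G> \<eta> w"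
proof -
  have "linf_on g (v + w) \<le> linf_on g v + linf_on g w" if "g \<in> \<G>" for g
  proof -
    have "g \<noteq> {}" using that ne by auto
    moreover have "\<bar>(v + w) $ j\<bar> \<le> linf_on g v + linf_on g w" if "j \<in> g" for j
      using linf_on_ge[OF that, of v] linf_on_ge[OF that, of w] by simp
    ultimately show ?thesis by (subst linf_on_def) simp
  qed
  then have "\<eta> g * linf_on g (v + w) \<le> \<eta> g * linf_on g v + \<eta> g * linf_on g w"
    if "g \<in> \<G>" for g
    using that pos by (metis distrib_left less_imp_le mult_left_mono)
  then show ?thesis
    unfolding group_norm_def sum.distrib[symmetric] by (intro sum_mono)
qed

lemma group_norm_scaleR: "group_norm \<G> \<eta> (c *\<^sub>R w) = \<bar>c\<bar> * group_norm \<G> \<eta> w"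
proof -
  have "linf_on g (c *\<^sub>R w) = \<bar>c\<bar> * linf_on g w" if "g \<in> \<G>" for g
  proof -
    have "g \<noteq> {}" using that ne by auto
    moreover have "mono (\<lambda>x. \<bar>c\<bar> * x)" by (simp add: mono_def mult_left_mono)
    ultimately show ?thesis
      unfolding linf_on_def
      by (subst mono_Max_commute[of "\<lambda>x. \<bar>c\<bar> * x"]) (simp_all add: image_image abs_mult)
  qed
  then show ?thesis
    unfolding group_norm_def sum_distrib_left
    by (intro sum.cong) (simp_all add: mult.left_commute)
qed

lemma compact_group_norm_ball: "compact {z. group_norm \<G> \<eta> z \<le> 1}"
proof -
  have "continuous_on UNIV (group_norm \<G> \<eta>)"
    unfolding group_norm_def[abs_def] using ne
    by (intro continuous_on_sum continuous_on_mult continuous_on_const continuous_on_linf_on) auto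
  then have "closed {z. group_norm \<G> \<eta> z \<le> 1}"
    by (intro closed_Collect_le continuous_on_const)
  moreover have "bounded {z. group_norm \<G> \<eta> z \<le> 1}"
  proof -
    have "\<forall>j. \<exists>g. g \<in> \<G> \<and> j \<in> g" by (meson in_some_group)
    then obtain f where f: "\<And>j. f j \<in> \<G> \<and> j \<in> f j" using choice[of "\<lambda>j g. g \<in> \<G> \<and> j \<in> g"] by auto
    have "norm z \<le> (\<Sum>j\<in>UNIV. 1 / \<eta> (f j))" if "group_norm \<G> \<eta> z \<le> 1" for z
    proof -
      have "\<bar>z $ j\<bar> \<le> 1 / \<eta> (f j)" for j
        using group_norm_ge[of "f j" j z] f[of j] pos that by (auto simp: field_simps)
      then show ?thesis
        by (intro order_trans[OF norm_le_l1_cart] sum_mono)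
    qed
    then show ?thesis by (auto simp: bounded_iff)
  qed
  ultimately show ?thesis by (simp add: compact_eq_bounded_closed)
qed

lemma dual_group_norm_max:
  shows "\<exists>z. group_norm \<G> \<eta> z \<le> 1 \<and> z \<bullet> \<kappa> = dual_norm (group_norm \<G> \<eta>) \<kappa>"
    and "group_norm \<G> \<eta> z \<le> 1 \<Longrightarrow> z \<bullet> \<kappa> \<le> dual_norm (group_norm \<G> \<eta>) \<kappa>"
proof -
  let ?B = "{z. group_norm \<G> \<eta> z \<le> 1}"
  have "0 \<in> ?B" using group_norm_eq_0_iff[of 0] by simp
  then have "\<exists>z\<in>?B. \<forall>y\<in>?B. y \<bullet> \<kappa> \<le> z \<bullet> \<kappa>"
    by (intro continuous_attains_sup compact_group_norm_ball continuous_on_inner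
        continuous_on_id continuous_on_const) auto
  then obtain z0 where z0: "z0 \<in> ?B" "\<And>y. y \<in> ?B \<Longrightarrow> y \<bullet> \<kappa> \<le> z0 \<bullet> \<kappa>" by blast
  then have eq: "dual_norm (group_norm \<G> \<eta>) \<kappa> = z0 \<bullet> \<kappa>"
    unfolding dual_norm_def by (intro cSup_eq_maximum) auto
  show "\<exists>z. group_norm \<G> \<eta> z \<le> 1 \<and> z \<bullet> \<kappa> = dual_norm (group_norm \<G> \<eta>) \<kappa>"
    using z0(1) eq by auto
  show "group_norm \<G> \<eta> z \<le> 1 \<Longrightarrow> z \<bullet> \<kappa> \<le> dual_norm (group_norm \<G> \<eta>) \<kappa>"
    using z0(2) eq by auto
qed

end

end

theory Submission imports Defs "HOL-Library.Set_Algebras" begin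

text \<open>
  If \<open>\<kappa> = (\<Sum>g. \<xi>\<^sup>g)\<close> is a feasible decomposition of value \<open>\<tau>\<close>, then Hoelder's inequality on each
  group bounds \<open>z \<bullet> \<kappa>\<close> by \<open>\<tau>\<close> on the unit ball of the norm.
  Conversely, let \<open>t\<close> be the dual norm of \<open>\<kappa>\<close>. The vectors with a decomposition of value \<open>t\<close> form a
  Minkowski sum of \<open>\<ell>\<^sub>1\<close> balls supported on the groups, a compact convex set whose support
  function is \<open>t\<close> times the norm; a hyperplane separating \<open>\<kappa>\<close> from it would contradict
  \<open>a \<bullet> \<kappa> \<le> t * group_norm \<G> \<eta> a\<close>.
\<close>

text \<open>The admissible columns for one group: with \<open>r = \<tau> * \<eta> g\<close> these
  are exactly the constraints that \<open>feasible\<close> puts on \<open>\<xi> g\<close>.\<close>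

definition l1_ball_on :: "'p::finite set \<Rightarrow> real \<Rightarrow> (real ^ 'p) set"
  where "l1_ball_on g r = {x. l1_norm x \<le> r \<and> (\<forall>j. j \<notin> g \<longrightarrow> x $ j = 0)}"

lemma l1_norm_nonneg: "0 \<le> l1_norm x"
  by (simp add: l1_norm_def sum_nonneg)

lemma l1_norm_axis: "l1_norm (axis j c) = \<bar>c\<bar>"
proof -
  have "l1_norm (axis j c) = (\<Sum>i\<in>UNIV. if i = j then \<bar>c\<bar> else 0)"
    unfolding l1_norm_def by (intro sum.cong) (auto simp: axis_def)
  then show ?thesis by simp
qed

lemma compact_l1_ball_on: "compact (l1_ball_on g r)"
proof -
  have "closed (l1_ball_on g r)"
    \<comment> \<open>The support condition becomes an intersection over \<open>j\<close> of unions
      of a constant set (\<open>j \<in> g\<close>) and the closed set where coordinate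
      \<open>j\<close> vanishes.\<close>
    unfolding l1_ball_on_def l1_norm_def Collect_conj_eq Collect_all_eq imp_conv_disj Collect_disj_eq
    by (intro closed_Int closed_INT closed_Un ballI closed_Collect_le closed_Collect_eq closed_Collect_const
        continuous_intros)
  moreover have "norm x \<le> r" if "x \<in> l1_ball_on g r" for x
    using norm_le_l1_cart[of x] that by (simp add: l1_ball_on_def l1_norm_def)
  ultimately show ?thesis by (auto simp: compact_eq_bounded_closed bounded_iff)
qed

lemma convex_l1_ball_on: "convex (l1_ball_on g r)"
proof (rule convexI)
  fix x y u v assume xy: "x \<in> l1_ball_on g r" "y \<in> l1_ball_on g r"
    and uv: "0 \<le> u" "0 \<le> v" "u + v = (1::real)"
  have "l1_norm (u *\<^sub>R x + v *\<^sub>R y) \<le> (\<Sum>j\<in>UNIV. u * \<bar>x $ j\<bar> + v * \<bar>y $ j\<bar>)"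
    unfolding l1_norm_def
  proof (rule sum_mono)
    show "\<bar>(u *\<^sub>R x + v *\<^sub>R y) $ j\<bar> \<le> u * \<bar>x $ j\<bar> + v * \<bar>y $ j\<bar>" for j
      using uv abs_triangle_ineq[of "u * x $ j" "v * y $ j"] by (simp add: abs_mult)
  qed
  also have "\<dots> = u * l1_norm x + v * l1_norm y"
    by (simp add: l1_norm_def sum.distrib sum_distrib_left)
  also have "\<dots> \<le> r"
    using xy uv by (intro convex_bound_le) (simp_all add: l1_ball_on_def)
  finally show "u *\<^sub>R x + v *\<^sub>R y \<in> l1_ball_on g r"
    using xy by (simp add: l1_ball_on_def)
qed

text \<open>Compactness is carried through the sum because Minkowski sums of merely closed sets may
  fail to be closed; the separation argument needs a closed sum.\<close>

lemma compact_sum_sets: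
  fixes S :: "'i \<Rightarrow> 'a::real_normed_vector set"
  assumes "finite I" and "\<And>i. i \<in> I \<Longrightarrow> compact (S i)"
  shows "compact (\<Sum>i\<in>I. S i)"
  using assms
proof (induction rule: finite_induct)
  case empty
  then show ?case by simp
next
  case (insert i I)
  then have "compact {x + y | x y. x \<in> S i \<and> y \<in> (\<Sum>i\<in>I. S i)}"
    by (intro compact_sums) auto
  moreover have "{x + y | x y. x \<in> S i \<and> y \<in> (\<Sum>i\<in>I. S i)} = (\<Sum>i\<in>insert i I. S i)"
    using insert.hyps by (auto simp: set_plus_def)
  ultimately show ?case by simp
qed

text \<open>Hoelder's inequality, summed coordinate by coordinate. A maximum over \<open>g\<close>
  alone suffices since coordinates outside \<open>g\<close> contribute zero to both sides.\<close>

lemma inner_le_linf_l1: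
  assumes "\<forall>j. j \<notin> g \<longrightarrow> x $ j = 0" and "g \<noteq> {}"
  shows "z \<bullet> x \<le> linf_on g z * l1_norm x"
proof -
  have "z $ j * x $ j \<le> linf_on g z * \<bar>x $ j\<bar>" for j
  proof (cases "j \<in> g")
    case True
    have "z $ j * x $ j \<le> \<bar>z $ j\<bar> * \<bar>x $ j\<bar>"
      by (metis abs_ge_self abs_mult)
    also have "\<dots> \<le> linf_on g z * \<bar>x $ j\<bar>"
      using True by (intro mult_right_mono linf_on_ge) auto
    finally show ?thesis .
  qed (use assms in simp)
  then show ?thesis
    by (auto simp: inner_vec_def l1_norm_def sum_distrib_left intro: sum_mono)
qed

text \<open>The equality case of Hoelder: all the mass \<open>r\<close> goes to one coordinate of
  \<open>g\<close> where \<open>a\<close> is largest in absolute value, with matching sign. If that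
  entry is zero, so is the witness.\<close>

lemma l1_ball_on_attains_linf:
  fixes g :: "'p::finite set"
  assumes "g \<noteq> {}" and "0 \<le> r"
  obtains x where "x \<in> l1_ball_on g r" and "a \<bullet> x = r * linf_on g a"
proof -
  have "linf_on g a \<in> (\<lambda>j. \<bar>a $ j\<bar>) ` g"
    unfolding linf_on_def using assms by (intro Max_in) auto
  then obtain j where j: "j \<in> g" "linf_on g a = \<bar>a $ j\<bar>" by blast
  show ?thesis
  proof
    show "axis j (r * sgn (a $ j)) \<in> l1_ball_on g r"
      using j(1) assms(2) l1_norm_axis[of j "r * sgn (a $ j)"]
      by (auto simp: l1_ball_on_def abs_mult abs_sgn_eq axis_def split: if_splits)
    show "a \<bullet> axis j (r * sgn (a $ j)) = r * linf_on g a"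
      using j by (simp add: inner_axis abs_sgn)
  qed
qed

text \<open>By homogeneity: a nonzero \<open>a\<close> is rescaled into the unit ball, where the
  dual norm bounds the inner product.\<close>

lemma inner_le_dual_norm:
  assumes "{} \<notin> \<G>" and "\<Union>\<G> = UNIV" and "\<forall>g\<in>\<G>. 0 < \<eta> g"
  shows "a \<bullet> \<kappa> \<le> dual_norm (group_norm \<G> \<eta>) \<kappa> * group_norm \<G> \<eta> a"
proof (cases "a = 0")
  case True
  then show ?thesis using group_norm_eq_0_iff[OF assms, of a] by simp
next
  case False
  let ?N = "group_norm \<G> \<eta> a"
  have N: "0 < ?N"
    using False group_norm_eq_0_iff[OF assms, of a] group_norm_nonneg[OF assms, of a] by linarith
  have "((1 / ?N) *\<^sub>R a) \<bullet> \<kappa> \<le> dual_norm (group_norm \<G> \<eta>) \<kappa>"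
    using N by (intro dual_group_norm_max(2)[OF assms]) (simp add: group_norm_scaleR[OF assms])
  then show ?thesis using N by (simp add: field_simps)
qed

lemma dual_norm_le_feasible:
  assumes "{} \<notin> \<G>" and "\<Union>\<G> = UNIV" and "\<forall>g\<in>\<G>. 0 < \<eta> g"
    and feas: "(\<xi>, \<tau>) \<in> feasible \<G> \<eta> \<kappa>"
  shows "dual_norm (group_norm \<G> \<eta>) \<kappa> \<le> \<tau>"
proof -
  note G = assms(1-3)
  have \<kappa>: "\<kappa> = (\<Sum>g\<in>\<G>. \<xi> g)"
    and \<xi>: "\<And>g. g \<in> \<G> \<Longrightarrow> l1_norm (\<xi> g) \<le> \<tau> * \<eta> g"
      "\<And>g. g \<in> \<G> \<Longrightarrow> \<forall>j. j \<notin> g \<longrightarrow> \<xi> g $ j = 0"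
    using feas by (auto simp: feasible_def)
  \<comment> \<open>Any single group forces \<open>\<tau>\<close> to be nonnegative, which the last
    estimate needs to replace \<open>group_norm \<G> \<eta> z\<close> by 1.\<close>
  obtain g where g: "g \<in> \<G>" using in_some_group[OF G] by blast
  have "0 \<le> \<tau> * \<eta> g" using \<xi>(1)[OF g] l1_norm_nonneg[of "\<xi> g"] by linarith
  then have \<tau>: "0 \<le> \<tau>" using G(3) g by (simp add: zero_le_mult_iff) force
  obtain z where z: "group_norm \<G> \<eta> z \<le> 1" "z \<bullet> \<kappa> = dual_norm (group_norm \<G> \<eta>) \<kappa>"
    using dual_group_norm_max(1)[OF G] by blast
  have "z \<bullet> \<xi> g \<le> \<tau> * (\<eta> g * linf_on g z)" if "g \<in> \<G>" for g
  proof -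
    have ne: "g \<noteq> {}" using that G(1) by auto
    have "z \<bullet> \<xi> g \<le> linf_on g z * l1_norm (\<xi> g)"
      using inner_le_linf_l1[OF \<xi>(2)[OF that] ne] .
    also have "\<dots> \<le> linf_on g z * (\<tau> * \<eta> g)"
      using \<xi>(1)[OF that] linf_on_nonneg[OF ne] by (rule mult_left_mono)
    finally show ?thesis by (simp add: mult_ac)
  qed
  then have "z \<bullet> \<kappa> \<le> \<tau> * group_norm \<G> \<eta> z"
    unfolding \<kappa> inner_sum_right group_norm_def sum_distrib_left by (rule sum_mono)
  also have "\<dots> \<le> \<tau>" using z(1) \<tau> by (simp add: mult_left_le)
  finally show ?thesis using z(2) by simp
qed

lemma dual_norm_feasible:
  fixes \<G> :: "'p::finite set set" and \<kappa> :: "real ^ 'p"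
  assumes "{} \<notin> \<G>" and "\<Union>\<G> = UNIV" and "\<forall>g\<in>\<G>. 0 < \<eta> g"
  shows "\<exists>\<xi>. (\<xi>, dual_norm (group_norm \<G> \<eta>) \<kappa>) \<in> feasible \<G> \<eta> \<kappa>"
proof -
  define t where "t = dual_norm (group_norm \<G> \<eta>) \<kappa>"
  define K where "K = (\<Sum>g\<in>\<G>. l1_ball_on g (t * \<eta> g))"
  have K_alt: "K = {\<Sum>g\<in>\<G>. \<xi> g | \<xi>. \<forall>g\<in>\<G>. \<xi> g \<in> l1_ball_on g (t * \<eta> g)}"
    unfolding K_def by (simp add: set_sum_alt)
  \<comment> \<open>The zero vector lies in the unit ball. The sign makes the radii
    \<open>t * \<eta> g\<close> nonnegative, so that the balls attain their support
    function.\<close>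
  have t: "0 \<le> t"
    using dual_group_norm_max(2)[OF assms, of 0 \<kappa>] group_norm_eq_0_iff[OF assms, of 0]
    by (simp add: t_def)
  have "\<kappa> \<in> K"
  proof (rule ccontr)
    assume "\<kappa> \<notin> K"
    moreover have "closed K"
      unfolding K_def by (intro compact_imp_closed compact_sum_sets compact_l1_ball_on) simp
    moreover have "convex K"
      unfolding K_def by (intro convex_set_sum convex_l1_ball_on)
    ultimately obtain a b where ab: "a \<bullet> \<kappa> < b" "\<And>x. x \<in> K \<Longrightarrow> b < a \<bullet> x"
      using separating_hyperplane_closed_point[of K \<kappa>] by blast
    \<comment> \<open>The hyperplane leaves \<open>\<kappa>\<close> on its lower side, so
      \<open>\<kappa>\<close> strictly exceeds all of \<open>K\<close> in direction
      \<open>- a\<close>. Maximising in each ball separately gives a point of \<open>K\<close> that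
      reaches \<open>t * group_norm \<G> \<eta> (- a)\<close>, hence at least the value at
      \<open>\<kappa>\<close>.\<close>
    have "\<exists>x. x \<in> l1_ball_on g (t * \<eta> g) \<and> (- a) \<bullet> x = t * \<eta> g * linf_on g (- a)"
      if "g \<in> \<G>" for g
    proof -
      have "g \<noteq> {}" "0 \<le> t * \<eta> g" using that assms t by (auto intro: less_imp_le)
      then show ?thesis by (metis l1_ball_on_attains_linf)
    qed
    then obtain \<xi> where \<xi>: "\<forall>g\<in>\<G>. \<xi> g \<in> l1_ball_on g (t * \<eta> g) \<and>
        (- a) \<bullet> \<xi> g = t * \<eta> g * linf_on g (- a)"
      by metis
    have "(- a) \<bullet> (\<Sum>g\<in>\<G>. \<xi> g) = t * group_norm \<G> \<eta> (- a)"
      using \<xi> unfolding inner_sum_right group_norm_def sum_distrib_left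
      by (intro sum.cong) (auto simp: mult_ac)
    moreover have "(\<Sum>g\<in>\<G>. \<xi> g) \<in> K" using \<xi> unfolding K_alt by blast
    moreover have "(- a) \<bullet> \<kappa> \<le> t * group_norm \<G> \<eta> (- a)"
      unfolding t_def by (rule inner_le_dual_norm[OF assms])
    ultimately show False using ab by fastforce
  qed
  then show ?thesis
    unfolding K_alt t_def[symmetric] by (auto simp: feasible_def l1_ball_on_def)
qed

theorem lemma8:
  fixes \<G> :: "'p::finite set set" and \<eta> :: "'p set \<Rightarrow> real" and \<kappa> :: "real ^ 'p"
  assumes "{} \<notin> \<G>" and "\<Union>\<G> = UNIV" and "\<forall>g\<in>\<G>. 0 < \<eta> g"
  shows "(\<exists>\<xi>. (\<xi>, dual_norm (group_norm \<G> \<eta>) \<kappa>) \<in> feasible \<G> \<eta> \<kappa>) \<and>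
         (\<forall>(\<xi>, \<tau>)\<in>feasible \<G> \<eta> \<kappa>. dual_norm (group_norm \<G> \<eta>) \<kappa> \<le> \<tau>)"
  using dual_norm_feasible[OF assms] dual_norm_le_feasible[OF assms] by blast

end
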